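(* Let $E$ be a Banach lattice and $T:E\to E$ an operator. If $T$ and $-T$ are both uo-demi Dunford–Pettis, then $T^2$ is a uo-demi Dunford–Pettis operator.
   Context: All Banach lattices are real; "operator" means bounded linear map. A net $(x_\alpha)$ in a Banach lattice $E$ is uo-convergent (unbounded order convergent) to $x$ if $|x_\alpha-x|\wedge y$ converges in order to $0$ for every $y\in E^+$. An operator $T:E\to E$ on a Banach lattice $E$ is uo-demi Dunford–Pettis (unbounded order demi Dunford–Pettis) if for every weakly null sequence $(x_n)$ in $E$ such that $(x_n-T(x_n))$ is uo-convergent to $0$, one has $\|x_n\|\to0$. *)

theory Defs
  imports "HOL-Analysis.Analysis" "HOL-Library.Lattice_Algebras"
begin

class banach_lattice = banach + ordered_real_vector + lattice_ab_group_add_abs +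
  assumes norm_lattice: "\<bar>x\<bar> \<le> \<bar>y\<bar> \<Longrightarrow> norm x \<le> norm y"

instance real :: banach_lattice
  by standard simp

text \<open>Nets decreasing to zero are represented by their ranges: the range of such a net is a
  downward directed set with infimum zero, and conversely every such set, indexed by itself with
  the reversed order, is a net decreasing to zero.\<close>

definition directed_down_to_zero :: "'a::{order,zero} set \<Rightarrow> bool" where
  "directed_down_to_zero D \<longleftrightarrow>
     D \<noteq> {} \<and>
     (\<forall>a\<in>D. \<forall>b\<in>D. \<exists>c\<in>D. c \<le> a \<and> c \<le> b) \<and>
     (\<forall>d\<in>D. 0 \<le> d) \<and>
     (\<forall>z. (\<forall>d\<in>D. z \<le> d) \<longrightarrow> z \<le> 0)"

text \<open>A net \<open>x\<close> converges in order to \<open>l\<close> if there is a net \<open>d\<close> decreasing to zero, possibly over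
  a different index set, such that each term of \<open>d\<close> eventually dominates \<open>\<bar>x i - l\<bar>\<close>. The filter
  \<open>F\<close> is the filter of tails of the index set of \<open>x\<close>.\<close>

definition order_converges ::
    "('i \<Rightarrow> 'a::lattice_ab_group_add_abs) \<Rightarrow> 'a \<Rightarrow> 'i filter \<Rightarrow> bool" where
  "order_converges x l F \<longleftrightarrow>
     (\<exists>D. directed_down_to_zero D \<and> (\<forall>d\<in>D. \<forall>\<^sub>F i in F. \<bar>x i - l\<bar> \<le> d))"

definition uo_converges ::
    "('i \<Rightarrow> 'a::lattice_ab_group_add_abs) \<Rightarrow> 'a \<Rightarrow> 'i filter \<Rightarrow> bool" where
  "uo_converges x l F \<longleftrightarrow> (\<forall>y\<ge>0. order_converges (\<lambda>i. inf \<bar>x i - l\<bar> y) 0 F)"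

definition weakly_null :: "(nat \<Rightarrow> 'a::real_normed_vector) \<Rightarrow> bool" where
  "weakly_null x \<longleftrightarrow> (\<forall>f :: 'a \<Rightarrow>\<^sub>L real. (\<lambda>n. blinfun_apply f (x n)) \<longlonglongrightarrow> 0)"

definition uo_demi_dunford_pettis :: "('a::banach_lattice \<Rightarrow>\<^sub>L 'a) \<Rightarrow> bool" where
  "uo_demi_dunford_pettis T \<longleftrightarrow>
     (\<forall>x. weakly_null x \<and> uo_converges (\<lambda>n. x n - blinfun_apply T (x n)) 0 sequentially
        \<longrightarrow> (\<lambda>n. norm (x n)) \<longlonglongrightarrow> 0)"

end

theory Submission
  imports Defs
begin

text \<open>If \<open>x\<close> is weakly null and \<open>x\<^sub>n - T\<^sup>2 x\<^sub>n\<close> is uo-null, then \<open>u\<^sub>n = x\<^sub>n + T x\<^sub>n\<close> is weakly null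
  with \<open>u\<^sub>n - T u\<^sub>n = x\<^sub>n - T\<^sup>2 x\<^sub>n\<close>, so \<open>u\<close> is norm null. Norm null sequences need not be uo-null,
  but their rapidly decreasing subsequences are: the tails of the series \<open>\<Sum>\<bar>u\<^sub>n\<bar>\<close> decrease to zero and
  dominate the terms. If \<open>\<parallel>x\<^sub>n\<parallel>\<close> did not tend to zero, a subsequence of \<open>x\<close> bounded away from zero
  would therefore contradict the hypothesis on \<open>- T\<close>, because \<open>x\<^sub>n - (- T) x\<^sub>n = u\<^sub>n\<close>.\<close>

text \<open>The positive part \<open>sup w 0\<close> lies below every
  \<open>\<bar>X n\<bar>\<close>, so monotonicity of the norm forces its norm to vanish. This turns
  norm limits into order statements.\<close>

lemma nonpos_if_le_norm_null:
  fixes w :: "'a::banach_lattice"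
  assumes "\<And>n. w \<le> \<bar>X n\<bar>" and "X \<longlonglongrightarrow> 0"
  shows "w \<le> 0"
proof -
  have "norm (sup w 0) \<le> norm (X n)" for n
    by (rule norm_lattice) (use assms(1)[of n] in simp)
  then have "norm (sup w 0) \<le> 0"
    using tendsto_norm_zero[OF assms(2)] by (meson Lim_bounded2)
  then have "sup w 0 = 0"
    by (simp only: norm_le_zero_iff)
  then show ?thesis
    by (simp add: le_iff_sup)
qed

text \<open>The order is norm closed because \<open>a - l\<close> lies below the norm null moduli
  \<open>\<bar>X n - l\<bar>\<close>.\<close>

lemma banach_lattice_le_limit:
  fixes a l :: "'a::banach_lattice"
  assumes "X \<longlonglongrightarrow> l" and "\<And>n. a \<le> X n"
  shows "a \<le> l"
proof -
  have "a - l \<le> \<bar>X n - l\<bar>" for n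
    using assms(2)[of n] abs_ge_self[of "X n - l"] by (meson diff_right_mono order_trans)
  moreover have "(\<lambda>n. X n - l) \<longlonglongrightarrow> 0"
    using assms(1) LIM_zero by blast
  ultimately show ?thesis
    using nonpos_if_le_norm_null[of "a - l" "\<lambda>n. X n - l"] by simp
qed

lemma norm_abs_banach_lattice: "norm \<bar>x\<bar> = norm (x :: 'a::banach_lattice)"
  by (intro antisym norm_lattice) simp_all

lemma order_converges_if_norm_summable:
  fixes z :: "nat \<Rightarrow> 'a::banach_lattice"
  assumes "summable (\<lambda>n. norm (z n))"
  shows "order_converges z 0 sequentially"
proof -
  \<comment> \<open>The tail starts at index \<open>n\<close> itself, so \<open>d n\<close>
    dominates \<open>\<bar>z n\<bar>\<close> as well as all later terms.\<close>
  define d where "d n = (\<Sum>k. \<bar>z (k + n)\<bar>)" for n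
  \<comment> \<open>Completeness enters here: an absolutely convergent series converges.\<close>
  have summable_abs: "summable (\<lambda>n. \<bar>z n\<bar>)"
    by (rule summable_norm_cancel) (use assms in \<open>simp add: norm_abs_banach_lattice\<close>)
  have sums: "(\<lambda>k. \<bar>z (k + n)\<bar>) sums d n" for n
    unfolding d_def by (rule summable_sums[OF summable_ignore_initial_segment[OF summable_abs]])
  have nonneg: "0 \<le> d n" for n
    using sums[of n, unfolded sums_def] by (rule banach_lattice_le_limit) (simp add: sum_nonneg)
  have Suc: "d n = \<bar>z n\<bar> + d (Suc n)" for n
    using sums_Suc[of "\<lambda>k. \<bar>z (k + n)\<bar>" "d (Suc n)"] sums[of "Suc n"] sums[of n]
    by (auto dest: sums_unique2 simp: add.commute)
  have decseq: "decseq d"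
    \<comment> \<open>Only the larger side \<open>d n\<close> is unfolded, leaving
      \<open>d (Suc n) \<le> \<bar>z n\<bar> + d (Suc n)\<close>.\<close>
    unfolding decseq_Suc_iff by (subst (2) Suc) simp
  have dominates: "\<bar>z k\<bar> \<le> d n" if "n \<le> k" for n k
  proof -
    have "\<bar>z k\<bar> \<le> d k"
      using Suc[of k] nonneg[of "Suc k"] by simp
    then show ?thesis
      using decseqD[OF decseq that] by order
  qed
  have "d \<longlonglongrightarrow> 0"
  proof -
    have "d = (\<lambda>n. (\<Sum>k. \<bar>z k\<bar>) - (\<Sum>k<n. \<bar>z k\<bar>))"
      unfolding d_def using suminf_minus_initial_segment[OF summable_abs] by auto
    then show ?thesis
      using tendsto_diff[OF tendsto_const[of "\<Sum>k. \<bar>z k\<bar>"] summable_LIMSEQ[OF summable_abs]] by simp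
  qed
  \<comment> \<open>Norm convergence of the nonnegative \<open>d\<close> to zero makes zero its
    infimum.\<close>
  then have "w \<le> 0" if "\<forall>n. w \<le> d n" for w
    using nonpos_if_le_norm_null[of w d] that nonneg by simp
  moreover have "\<exists>c. d c \<le> d a \<and> d c \<le> d b" for a b
    using decseqD[OF decseq] by (meson max.cobounded1 max.cobounded2)
  ultimately have "directed_down_to_zero (range d)"
    unfolding directed_down_to_zero_def using nonneg by auto
  moreover have "\<forall>\<^sub>F k in sequentially. \<bar>z k - 0\<bar> \<le> d n" for n
    using dominates eventually_sequentially by auto
  ultimately show ?thesis
    unfolding order_converges_def by blast
qed

text \<open>Truncating by \<open>y\<close> only shrinks the moduli, so the same dominating set
  \<open>D\<close> works for every \<open>y\<close>.\<close>

lemma order_converges_imp_uo_converges: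
  fixes x :: "'i \<Rightarrow> 'a::lattice_ab_group_add_abs"
  assumes "order_converges x l F"
  shows "uo_converges x l F"
  unfolding uo_converges_def
proof (intro allI impI)
  fix y :: 'a
  assume "0 \<le> y"
  then have le: "\<bar>inf \<bar>x i - l\<bar> y - 0\<bar> \<le> \<bar>x i - l\<bar>" for i
    by simp
  obtain D where D: "directed_down_to_zero D"
    and dominated: "\<And>d. d \<in> D \<Longrightarrow> \<forall>\<^sub>F i in F. \<bar>x i - l\<bar> \<le> d"
    using assms unfolding order_converges_def by blast
  have "\<forall>\<^sub>F i in F. \<bar>inf \<bar>x i - l\<bar> y - 0\<bar> \<le> d" if "d \<in> D" for d
    using dominated[OF that] by (rule eventually_mono) (rule order_trans[OF le])
  with D show "order_converges (\<lambda>i. inf \<bar>x i - l\<bar> y) 0 F"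
    unfolding order_converges_def by blast
qed

lemma weakly_null_subseq:
  assumes "weakly_null x" and "strict_mono r"
  shows "weakly_null (\<lambda>n. x (r n))"
  using assms LIMSEQ_subseq_LIMSEQ unfolding weakly_null_def comp_def by blast

lemma weakly_null_add:
  fixes x y :: "nat \<Rightarrow> 'a::real_normed_vector"
  assumes "weakly_null x" and "weakly_null y"
  shows "weakly_null (\<lambda>n. x n + y n)"
  unfolding weakly_null_def
proof
  fix f :: "'a \<Rightarrow>\<^sub>L real"
  show "(\<lambda>n. blinfun_apply f (x n + y n)) \<longlonglongrightarrow> 0"
    unfolding blinfun.add_right
    using assms by (intro tendsto_add_zero) (simp_all add: weakly_null_def)
qed

text \<open>A functional \<open>f\<close> on the target pulls back to the functional
  \<open>f o\<^sub>L T\<close> on the source.\<close>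

lemma weakly_null_blinfun:
  fixes T :: "'a::real_normed_vector \<Rightarrow>\<^sub>L 'b::real_normed_vector"
  assumes "weakly_null x"
  shows "weakly_null (\<lambda>n. blinfun_apply T (x n))"
  unfolding weakly_null_def
proof
  fix f :: "'b \<Rightarrow>\<^sub>L real"
  show "(\<lambda>n. blinfun_apply f (blinfun_apply T (x n))) \<longlonglongrightarrow> 0"
    using assms[unfolded weakly_null_def, rule_format, of "f o\<^sub>L T"] by simp
qed

text \<open>A single subsequence must do both jobs. This is possible because \<open>u\<close> is
  eventually small while \<open>x\<close> is large at arbitrarily late indices.\<close>

lemma norm_null_rapid_subseq:
  fixes x u :: "nat \<Rightarrow> 'a::real_normed_vector"
  assumes "u \<longlonglongrightarrow> 0" and "\<not> x \<longlonglongrightarrow> 0"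
  obtains r e where "strict_mono r" and "0 < e" and "\<And>n. e \<le> norm (x (r n))"
    and "summable (\<lambda>n. norm (u (r n)))"
proof -
  obtain e where "0 < e" and large: "\<And>N. \<exists>n\<ge>N. e \<le> norm (x n)"
    using assms(2) unfolding LIMSEQ_iff by (auto simp: not_less)
  have step: "\<exists>n>m. e \<le> norm (x n) \<and> norm (u n) < (1/2) ^ k" for m k
  proof -
    have "(0::real) < (1/2) ^ k"
      by simp
    then obtain N where "\<And>n. N \<le> n \<Longrightarrow> norm (u n) < (1/2) ^ k"
      using LIMSEQ_D[OF assms(1)] by (metis diff_zero)
    \<comment> \<open>\<open>Suc m\<close> makes the new index strictly larger than
      \<open>m\<close>, as a subsequence requires.\<close>
    moreover obtain n where "max N (Suc m) \<le> n" and "e \<le> norm (x n)"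
      using large by blast
    ultimately show ?thesis
      by (intro exI[of _ n]) auto
  qed
  \<comment> \<open>The bound depends on the position \<open>k\<close>, not on the index
    \<open>r k\<close>, so a geometric series dominates the chosen norms.\<close>
  have "\<exists>r. \<forall>k. (e \<le> norm (x (r k)) \<and> norm (u (r k)) < (1/2) ^ k) \<and> r k < r (Suc k)"
    by (rule dependent_nat_choice) (use step in blast)+
  then obtain r where r: "\<And>k. e \<le> norm (x (r k)) \<and> norm (u (r k)) < (1/2) ^ k"
      "\<And>k. r k < r (Suc k)"
    by blast
  have "summable (\<lambda>k. norm (u (r k)))"
    by (rule summable_comparison_test'[where g = "\<lambda>k. (1/2) ^ k" and N = 0])
      (use r(1) in \<open>auto intro: less_imp_le\<close>)
  with r \<open>0 < e\<close> show ?thesis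
    by (intro that) (auto simp: strict_mono_Suc_iff)
qed

theorem proposition5p4:
  fixes T :: "'a::banach_lattice \<Rightarrow>\<^sub>L 'a"
  assumes "uo_demi_dunford_pettis T"
    and "uo_demi_dunford_pettis (- T)"
  shows "uo_demi_dunford_pettis (T o\<^sub>L T)"
  unfolding uo_demi_dunford_pettis_def
proof (intro allI impI, elim conjE)
  fix x
  assume weak: "weakly_null x"
    and uo: "uo_converges (\<lambda>n. x n - blinfun_apply (T o\<^sub>L T) (x n)) 0 sequentially"
  define u where "u n = x n + blinfun_apply T (x n)" for n
  have "weakly_null u"
    unfolding u_def using weak by (intro weakly_null_add weakly_null_blinfun)
  moreover have "(\<lambda>n. u n - blinfun_apply T (u n)) = (\<lambda>n. x n - blinfun_apply (T o\<^sub>L T) (x n))"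
    by (simp add: u_def blinfun.add_right)
  ultimately have "(\<lambda>n. norm (u n)) \<longlonglongrightarrow> 0"
    using assms(1) uo unfolding uo_demi_dunford_pettis_def by presburger
  then have u_null: "u \<longlonglongrightarrow> 0"
    by (rule tendsto_norm_zero_cancel)
  show "(\<lambda>n. norm (x n)) \<longlonglongrightarrow> 0"
  proof (rule ccontr)
    assume "\<not> (\<lambda>n. norm (x n)) \<longlonglongrightarrow> 0"
    then have "\<not> x \<longlonglongrightarrow> 0"
      using tendsto_norm_zero by blast
    with u_null obtain r e where "strict_mono r" and e: "0 < e" "\<And>n. e \<le> norm (x (r n))"
      and "summable (\<lambda>n. norm (u (r n)))"
      by (rule norm_null_rapid_subseq) auto
    then have "weakly_null (\<lambda>n. x (r n))" and "uo_converges (\<lambda>n. u (r n)) 0 sequentially"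
      using weak by (auto intro: weakly_null_subseq order_converges_imp_uo_converges
          order_converges_if_norm_summable)
    \<comment> \<open>The hypothesis on \<open>- T\<close> is applied to the subsequence, not to
      \<open>x\<close>: only along \<open>r\<close> is \<open>u\<close> known to be uo-null.\<close>
    then have "(\<lambda>n. norm (x (r n))) \<longlonglongrightarrow> 0"
      using assms(2) unfolding uo_demi_dunford_pettis_def u_def by (simp add: blinfun.minus_left)
    then have "e \<le> 0"
      using e(2) by (meson Lim_bounded2)
    with e(1) show False
      by simp
  qed
qed

end
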